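(* Let $B\in\mathcal{O}_{\mathfrak{b}}$ be a simple $\mathfrak{b}$-module. Then: (a) $\mathrm{ord}_{\mathfrak{b}}(B)=\mathrm{ord}_{\mathfrak{b}}(v)<\infty$ for all nonzero $v\in B$. (b) $\mathrm{ord}_{\mathfrak{b}}(B)=0$ if and only if $B$ is one dimensional. (c) If $B$ is nontrivial, then the action of $d_r$ on $B$ is bijective, where $r=\mathrm{ord}_{\mathfrak{b}}(B)$. Consequently, $B$ is a simple $\mathfrak{a}_r$-module for some $r\in\mathbb{N}$ (that is, the $\mathfrak{b}$-action on $B$ factors through $\mathfrak{a}_r$).
   Context: $\mathbb{N}$ is the set of positive integers. All Lie algebras and modules are over $\mathbb{C}$. $\mathfrak{b}$ is the complex Lie algebra with basis $\{d_i : i\ge 0\}$ (where $d_i=t^{i+1}\frac{d}{dt}$) and bracket $[d_n,d_m]=(m-n)d_{m+n}$. For $r\in\mathbb{Z}_{\ge 0}$, $\mathfrak{V}^{(r)}=\mathrm{span}\{d_i : i\ge r\}$, and $\mathfrak{a}_r=\mathfrak{b}/\mathfrak{V}^{(r+1)}$. $\mathcal{O}_{\mathfrak{b}}$ is the category of all $\mathfrak{b}$-modules $B$ such that for every $w\in B$ there is a nonnegative integer $n$ (depending on $w$) with $d_iw=0$ for all $i\ge n$. A module $V$ over a Lie algebra $L$ is trivial if $LV=0$, and nontrivial otherwise. For a $\mathfrak{b}$-module $B$ and $0\ne v\in B$, $\mathrm{ord}_{\mathfrak{b}}(v)$ is the minimal nonnegative integer $r$ with $d_{r+i}v=0$ for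 all $i\ge1$, or $\infty$ if no such $r$ exists; $\mathrm{ord}_{\mathfrak{b}}(B)$ is the maximal order of all nonzero elements of $B$, or $\infty$ if this maximum does not exist. *)

theory Defs
  imports Complex_Main "HOL-Library.Extended_Nat"
    "HOL-Computational_Algebra.Polynomial" "HOL-Algebra.QuotRing" "HOL-Algebra.Module"
begin

hide_const (open) Polynomial.smult Polynomial.order

text \<open>Lie algebras over \<open>\<complex>\<close> are carried by the library's record of algebras over a ring:
  \<^const>\<open>mult\<close> is the Lie bracket, and the field \<^const>\<open>one\<close> has no meaning.\<close>

definition complex_ring :: "complex ring" where
  "complex_ring = \<lparr>carrier = UNIV, mult = (*), one = 1, zero = 0, add = (+)\<rparr>"

locale lie_algebra = Module.module complex_ring L
  for L :: "(complex, 'a, 'm) module_scheme" (structure) +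
  assumes bracket_closed:
      "\<lbrakk>x \<in> carrier L; y \<in> carrier L\<rbrakk> \<Longrightarrow> x \<otimes>\<^bsub>L\<^esub> y \<in> carrier L"
    and bracket_add_left:
      "\<lbrakk>x \<in> carrier L; y \<in> carrier L; z \<in> carrier L\<rbrakk> \<Longrightarrow>
        (x \<oplus>\<^bsub>L\<^esub> y) \<otimes>\<^bsub>L\<^esub> z = x \<otimes>\<^bsub>L\<^esub> z \<oplus>\<^bsub>L\<^esub> y \<otimes>\<^bsub>L\<^esub> z"
    and bracket_add_right:
      "\<lbrakk>x \<in> carrier L; y \<in> carrier L; z \<in> carrier L\<rbrakk> \<Longrightarrow>
        x \<otimes>\<^bsub>L\<^esub> (y \<oplus>\<^bsub>L\<^esub> z) = x \<otimes>\<^bsub>L\<^esub> y \<oplus>\<^bsub>L\<^esub> x \<otimes>\<^bsub>L\<^esub> z"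
    and bracket_smult_left:
      "\<lbrakk>x \<in> carrier L; y \<in> carrier L\<rbrakk> \<Longrightarrow> (c \<odot>\<^bsub>L\<^esub> x) \<otimes>\<^bsub>L\<^esub> y = c \<odot>\<^bsub>L\<^esub> (x \<otimes>\<^bsub>L\<^esub> y)"
    and bracket_smult_right:
      "\<lbrakk>x \<in> carrier L; y \<in> carrier L\<rbrakk> \<Longrightarrow> x \<otimes>\<^bsub>L\<^esub> (c \<odot>\<^bsub>L\<^esub> y) = c \<odot>\<^bsub>L\<^esub> (x \<otimes>\<^bsub>L\<^esub> y)"
    and bracket_self: "x \<in> carrier L \<Longrightarrow> x \<otimes>\<^bsub>L\<^esub> x = \<zero>\<^bsub>L\<^esub>"
    and jacobi:
      "\<lbrakk>x \<in> carrier L; y \<in> carrier L; z \<in> carrier L\<rbrakk> \<Longrightarrow>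
        x \<otimes>\<^bsub>L\<^esub> (y \<otimes>\<^bsub>L\<^esub> z) \<oplus>\<^bsub>L\<^esub> y \<otimes>\<^bsub>L\<^esub> (z \<otimes>\<^bsub>L\<^esub> x) \<oplus>\<^bsub>L\<^esub> z \<otimes>\<^bsub>L\<^esub> (x \<otimes>\<^bsub>L\<^esub> y) = \<zero>\<^bsub>L\<^esub>"

locale lie_ideal = lie_algebra L for L :: "(complex, 'a, 'm) module_scheme" (structure) +
  fixes I :: "'a set"
  assumes ideal_additive: "additive_subgroup I L"
    and ideal_smult: "x \<in> I \<Longrightarrow> c \<odot>\<^bsub>L\<^esub> x \<in> I"
    and ideal_bracket: "\<lbrakk>x \<in> carrier L; y \<in> I\<rbrakk> \<Longrightarrow> x \<otimes>\<^bsub>L\<^esub> y \<in> I"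

definition quotient_lie ::
    "(complex, 'a, 'm) module_scheme \<Rightarrow> 'a set \<Rightarrow> (complex, 'a set) module" where
  "quotient_lie L I =
    ring.extend (L Quot I) \<lparr>smult = (\<lambda>c A. \<Union>a\<in>A. I +>\<^bsub>L\<^esub> (c \<odot>\<^bsub>L\<^esub> a))\<rparr>"

text \<open>The module is the whole type \<^typ>\<open>'v\<close>; \<open>act x v\<close> is constrained only for
  \<open>x\<close> in the carrier of \<open>L\<close>.\<close>

locale lie_module = lie_algebra L + V: vector_space scale
  for L :: "(complex, 'a, 'm) module_scheme" (structure)
    and scale :: "complex \<Rightarrow> 'v::ab_group_add \<Rightarrow> 'v" +
  fixes act :: "'a \<Rightarrow> 'v \<Rightarrow> 'v"
  assumes act_linear: "x \<in> carrier L \<Longrightarrow> Vector_Spaces.linear scale scale (act x)"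
    and act_add: "\<lbrakk>x \<in> carrier L; y \<in> carrier L\<rbrakk> \<Longrightarrow> act (x \<oplus>\<^bsub>L\<^esub> y) v = act x v + act y v"
    and act_smult: "x \<in> carrier L \<Longrightarrow> act (c \<odot>\<^bsub>L\<^esub> x) v = scale c (act x v)"
    and act_bracket:
      "\<lbrakk>x \<in> carrier L; y \<in> carrier L\<rbrakk> \<Longrightarrow>
        act (x \<otimes>\<^bsub>L\<^esub> y) v = act x (act y v) - act y (act x v)"

definition lie_submodule ::
    "(complex, 'a, 'm) module_scheme \<Rightarrow> (complex \<Rightarrow> 'v \<Rightarrow> 'v) \<Rightarrow>
      ('a \<Rightarrow> 'v::ab_group_add \<Rightarrow> 'v) \<Rightarrow> 'v set \<Rightarrow> bool" where
  "lie_submodule L scale act U \<longleftrightarrow>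
    module.subspace scale U \<and> (\<forall>x\<in>carrier L. \<forall>u\<in>U. act x u \<in> U)"

definition simple_lie_module ::
    "(complex, 'a, 'm) module_scheme \<Rightarrow> (complex \<Rightarrow> 'v \<Rightarrow> 'v) \<Rightarrow>
      ('a \<Rightarrow> 'v::ab_group_add \<Rightarrow> 'v) \<Rightarrow> bool" where
  "simple_lie_module L scale act \<longleftrightarrow>
    lie_module L scale act \<and> (UNIV :: 'v set) \<noteq> {0} \<and>
    (\<forall>U. lie_submodule L scale act U \<longrightarrow> U = {0} \<or> U = UNIV)"

definition trivial_lie_module ::
    "(complex, 'a, 'm) module_scheme \<Rightarrow> ('a \<Rightarrow> 'v::ab_group_add \<Rightarrow> 'v) \<Rightarrow> bool" where
  "trivial_lie_module L act \<longleftrightarrow> (\<forall>x\<in>carrier L. \<forall>v. act x v = 0)"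


text \<open>The polynomial \<open>p\<close> stands for the vector field \<open>p(t) d/dt\<close>, so that the bracket of
  \<open>p\<close> and \<open>q\<close> is the commutator \<open>p q' - q p'\<close>.\<close>

definition d :: "nat \<Rightarrow> complex poly" where
  "d i = monom 1 (i + 1)"

definition V_ideal :: "nat \<Rightarrow> complex poly set" where
  "V_ideal r = module.span Polynomial.smult (d ` {r..})"

definition lie_b :: "(complex, complex poly) module" where
  "lie_b = \<lparr>carrier = module.span Polynomial.smult (range d),
    mult = (\<lambda>p q. p * pderiv q - q * pderiv p), one = 0, zero = 0, add = (+),
    smult = Polynomial.smult\<rparr>"

definition lie_a :: "nat \<Rightarrow> (complex, complex poly set) module" where
  "lie_a r = quotient_lie lie_b (V_ideal (r + 1))"

definition in_category_O ::
    "(complex \<Rightarrow> 'v \<Rightarrow> 'v) \<Rightarrow> (complex poly \<Rightarrow> 'v::ab_group_add \<Rightarrow> 'v) \<Rightarrow> bool" where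
  "in_category_O scale act \<longleftrightarrow>
    lie_module lie_b scale act \<and> (\<forall>w. \<exists>n. \<forall>i\<ge>n. act (d i) w = 0)"

definition vec_ord :: "(complex poly \<Rightarrow> 'v::ab_group_add \<Rightarrow> 'v) \<Rightarrow> 'v \<Rightarrow> enat" where
  "vec_ord act v =
    (if \<exists>r. \<forall>i\<ge>1. act (d (r + i)) v = 0
     then enat (LEAST r. \<forall>i\<ge>1. act (d (r + i)) v = 0) else \<infinity>)"

definition mod_ord :: "(complex poly \<Rightarrow> 'v::ab_group_add \<Rightarrow> 'v) \<Rightarrow> enat" where
  "mod_ord act =
    (if \<exists>v. v \<noteq> 0 \<and> (\<forall>w. w \<noteq> 0 \<longrightarrow> vec_ord act w \<le> vec_ord act v)
     then (GREATEST n. \<exists>v. v \<noteq> 0 \<and> n = vec_ord act v) else \<infinity>)"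


lemma vector_space_poly: "vector_space (Polynomial.smult :: complex \<Rightarrow> _)"
  by unfold_locales (auto simp: smult_add_right smult_add_left)

interpretation poly_vs: vector_space "Polynomial.smult :: complex \<Rightarrow> complex poly \<Rightarrow> complex poly"
  by (rule vector_space_poly)

lemma lie_b_bracket_d:
  "d n \<otimes>\<^bsub>lie_b\<^esub> d m = (of_nat m - of_nat n) \<odot>\<^bsub>lie_b\<^esub> d (m + n)"
  by (simp add: lie_b_def d_def pderiv_monom mult_monom smult_monom diff_monom add.commute)

lemma inj_d: "inj d"
  by (auto simp: inj_def d_def monom_eq_iff')

lemma independent_d: "\<not> module.dependent Polynomial.smult (range d)"
proof
  assume "module.dependent Polynomial.smult (range d)"
  then obtain T u v where T: "finite T" "T \<subseteq> range d" and sum0: "(\<Sum>w\<in>T. Polynomial.smult (u w) w) = 0"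
    and v: "v \<in> T" "u v \<noteq> 0"
    unfolding poly_vs.dependent_explicit by blast
  obtain i where i: "v = d i" using v T by blast
  have "0 = (\<Sum>w\<in>T. u w * coeff w (i + 1))"
    using arg_cong[OF sum0, of "\<lambda>p. coeff p (i + 1)"] by (simp add: coeff_sum)
  also have "\<dots> = (\<Sum>w\<in>T. if w = v then u v else 0)"
    using T by (intro sum.cong) (auto simp: i d_def split: if_splits)
  also have "\<dots> = u v" using T v by simp
  finally show False using v by simp
qed

lemma V_ideal_eq: "V_ideal r = {p. \<forall>i\<le>r. coeff p i = 0}"
proof -
  have sub: "module.subspace Polynomial.smult {p :: complex poly. \<forall>i\<le>r. coeff p i = 0}"
    by (auto simp: poly_vs.subspace_def)
  have 1: "V_ideal r \<subseteq> {p. \<forall>i\<le>r. coeff p i = 0}"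
    unfolding V_ideal_def by (rule poly_vs.span_minimal[OF _ sub]) (auto simp: d_def)
  have "p \<in> V_ideal r" if "\<forall>i\<le>r. coeff p i = 0" for p
  proof -
    have "monom (coeff p i) i \<in> V_ideal r" for i
    proof (cases "i \<le> r")
      case False
      then have "d (i - 1) \<in> d ` {r..}" by auto
      then have "Polynomial.smult (coeff p i) (d (i - 1)) \<in> V_ideal r"
        unfolding V_ideal_def by (intro poly_vs.span_scale poly_vs.span_base)
      with False show ?thesis by (simp add: d_def smult_monom)
    qed (use that in \<open>simp add: V_ideal_def poly_vs.span_zero\<close>)
    then have "(\<Sum>i\<le>degree p. monom (coeff p i) i) \<in> V_ideal r"
      unfolding V_ideal_def by (intro poly_vs.span_sum)
    then show ?thesis by (simp add: poly_as_sum_of_monoms)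
  qed
  with 1 show ?thesis by blast
qed

lemma carrier_lie_b: "carrier lie_b = V_ideal 0"
  by (simp add: lie_b_def V_ideal_def atLeast_0)

lemma complex_ring_cring: "cring complex_ring"
  by (rule cringI) (auto simp: complex_ring_def algebra_simps
      intro!: abelian_groupI comm_monoidI exI[of _ "- _"])

lemma coeff_bracket_low:
  fixes p q :: "complex poly"
  assumes "coeff p 0 = 0" "\<forall>i\<le>r. coeff q i = 0"
  shows "\<forall>i\<le>r. coeff (p * pderiv q - q * pderiv p) i = 0"
proof (intro allI impI)
  fix i assume i: "i \<le> r"
  have "coeff (p * pderiv q) i = 0"
    unfolding coeff_mult
  proof (rule sum.neutral, rule ballI)
    fix j assume j: "j \<in> {..i}"
    show "coeff p j * coeff (pderiv q) (i - j) = 0"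
      using assms i j by (cases j) (auto simp: coeff_pderiv Suc_diff_le[symmetric])
  qed
  moreover have "coeff (q * pderiv p) i = 0"
    unfolding coeff_mult using assms i by (intro sum.neutral) auto
  ultimately show "coeff (p * pderiv q - q * pderiv p) i = 0" by simp
qed

lemma lie_algebra_lie_b: "lie_algebra lie_b"
proof -
  have "abelian_group lie_b"
    by (rule abelian_groupI)
      (auto simp: carrier_lie_b V_ideal_eq lie_b_def[THEN arg_cong[of _ _ add]]
        lie_b_def[THEN arg_cong[of _ _ zero]] algebra_simps intro!: exI[of _ "- _"])
  then have "Module.module complex_ring lie_b"
    by (intro moduleI complex_ring_cring)
      (simp_all add: carrier_lie_b V_ideal_eq,
       simp_all add: lie_b_def complex_ring_def smult_add_left smult_add_right)
  then show ?thesis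
  proof (intro lie_algebra.intro lie_algebra_axioms.intro)
    fix x y assume "x \<in> carrier lie_b" "y \<in> carrier lie_b"
    then show "x \<otimes>\<^bsub>lie_b\<^esub> y \<in> carrier lie_b"
      using coeff_bracket_low[of x 0 y]
      by (simp add: carrier_lie_b V_ideal_eq) (simp add: lie_b_def)
  qed (auto simp: lie_b_def pderiv_add pderiv_smult pderiv_diff pderiv_mult algebra_simps
        smult_add_right smult_diff_right)
qed

lemma lie_ideal_V_ideal: "lie_ideal lie_b (V_ideal r)"
proof -
  interpret lie_algebra lie_b by (rule lie_algebra_lie_b)
  show ?thesis
  proof (intro lie_ideal.intro[OF lie_algebra_axioms] lie_ideal_axioms.intro)
    fix x y assume "x \<in> carrier lie_b" "y \<in> V_ideal r"
    then show "x \<otimes>\<^bsub>lie_b\<^esub> y \<in> V_ideal r"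
      using coeff_bracket_low[of x r y]
      by (simp add: carrier_lie_b V_ideal_eq) (simp add: lie_b_def)
  next
    have inv: "\<ominus>\<^bsub>lie_b\<^esub> x = - x" if "x \<in> V_ideal r" for x
      using that by (intro M.minus_equality)
        (simp_all add: carrier_lie_b V_ideal_eq, simp_all add: lie_b_def)
    show "additive_subgroup (V_ideal r) lie_b"
    proof (intro additive_subgroup.intro M.add.subgroupI)
      show "V_ideal r \<noteq> {}" by (auto simp: V_ideal_eq intro: exI[of _ 0])
    qed (simp_all add: inv a_inv_def[symmetric] carrier_lie_b, auto simp: V_ideal_eq lie_b_def)
  qed (simp add: V_ideal_eq lie_b_def)
qed

context lie_ideal
begin

lemma abelian_subgroup_I: "abelian_subgroup I L"
  by (rule abelian_subgroupI3[OF ideal_additive]) (rule M.abelian_group_axioms)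

interpretation S: abelian_subgroup I L by (rule abelian_subgroup_I)

lemma bracket_skew:
  assumes x: "x \<in> carrier L" and y: "y \<in> carrier L"
  shows "y \<otimes>\<^bsub>L\<^esub> x = \<ominus>\<^bsub>L\<^esub> (x \<otimes>\<^bsub>L\<^esub> y)"
proof -
  note c = bracket_closed[OF x y] bracket_closed[OF y x]
  have xy: "x \<oplus>\<^bsub>L\<^esub> y \<in> carrier L" using x y by (rule M.a_closed)
  have "\<zero>\<^bsub>L\<^esub> = (x \<oplus>\<^bsub>L\<^esub> y) \<otimes>\<^bsub>L\<^esub> (x \<oplus>\<^bsub>L\<^esub> y)"
    by (rule bracket_self[OF xy, symmetric])
  also have "\<dots> = y \<otimes>\<^bsub>L\<^esub> x \<oplus>\<^bsub>L\<^esub> x \<otimes>\<^bsub>L\<^esub> y"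
    unfolding bracket_add_right[OF xy x y] bracket_add_left[OF x y x] bracket_add_left[OF x y y]
      bracket_self[OF x] bracket_self[OF y]
    using c by simp
  finally show ?thesis using c by (intro M.minus_equality[symmetric]) simp_all
qed

lemma ideal_bracket': "\<lbrakk>x \<in> I; y \<in> carrier L\<rbrakk> \<Longrightarrow> x \<otimes>\<^bsub>L\<^esub> y \<in> I"
  using bracket_skew[of y x] ideal_bracket[of y x] S.a_inv_closed S.a_Hcarr by simp

lemma rcosetE:
  assumes "x' \<in> I +>\<^bsub>L\<^esub> x" obtains h where "h \<in> I" "x' = h \<oplus>\<^bsub>L\<^esub> x"
  using assms by (auto simp: a_r_coset_def r_coset_def)

lemma rcoset_absorb: "\<lbrakk>h \<in> I; x \<in> carrier L\<rbrakk> \<Longrightarrow> I +>\<^bsub>L\<^esub> (h \<oplus>\<^bsub>L\<^esub> x) = I +>\<^bsub>L\<^esub> x"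
  by (rule S.a_repr_independence'[symmetric]) (auto simp: a_r_coset_def r_coset_def)

lemma rcoset_bracket:
  assumes x: "x \<in> carrier L" and y: "y \<in> carrier L"
  shows "rcoset_mult L I (I +>\<^bsub>L\<^esub> x) (I +>\<^bsub>L\<^esub> y) = I +>\<^bsub>L\<^esub> (x \<otimes>\<^bsub>L\<^esub> y)"
proof -
  have "I +>\<^bsub>L\<^esub> (x' \<otimes>\<^bsub>L\<^esub> y') = I +>\<^bsub>L\<^esub> (x \<otimes>\<^bsub>L\<^esub> y)"
    if x': "x' \<in> I +>\<^bsub>L\<^esub> x" and y': "y' \<in> I +>\<^bsub>L\<^esub> y" for x' y'
  proof -
    obtain h k where h: "h \<in> I" "x' = h \<oplus>\<^bsub>L\<^esub> x" and k: "k \<in> I" "y' = k \<oplus>\<^bsub>L\<^esub> y"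
      using x' y' by (metis rcosetE)
    have hk: "h \<in> carrier L" "k \<in> carrier L" using h k S.a_Hcarr by auto
    have "x' \<otimes>\<^bsub>L\<^esub> y' = (h \<otimes>\<^bsub>L\<^esub> y' \<oplus>\<^bsub>L\<^esub> x \<otimes>\<^bsub>L\<^esub> k) \<oplus>\<^bsub>L\<^esub> x \<otimes>\<^bsub>L\<^esub> y"
      using hk x y by (simp add: h k bracket_add_left bracket_add_right bracket_closed M.a_assoc M.a_lcomm)
    moreover have "h \<otimes>\<^bsub>L\<^esub> y' \<oplus>\<^bsub>L\<^esub> x \<otimes>\<^bsub>L\<^esub> k \<in> I"
      using h k hk x y by (intro S.a_closed ideal_bracket ideal_bracket') auto
    ultimately show ?thesis using rcoset_absorb bracket_closed x y by simp
  qed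
  moreover have "x \<in> I +>\<^bsub>L\<^esub> x" "y \<in> I +>\<^bsub>L\<^esub> y" using x y S.a_rcos_self by auto
  ultimately show ?thesis unfolding rcoset_mult_def by blast
qed

lemma rcoset_smult:
  assumes x: "x \<in> carrier L"
  shows "c \<odot>\<^bsub>quotient_lie L I\<^esub> (I +>\<^bsub>L\<^esub> x) = I +>\<^bsub>L\<^esub> (c \<odot>\<^bsub>L\<^esub> x)"
proof -
  have c: "c \<in> carrier complex_ring" by (simp add: complex_ring_def)
  have "I +>\<^bsub>L\<^esub> (c \<odot>\<^bsub>L\<^esub> x') = I +>\<^bsub>L\<^esub> (c \<odot>\<^bsub>L\<^esub> x)" if x': "x' \<in> I +>\<^bsub>L\<^esub> x" for x'
  proof -
    obtain h where h: "h \<in> I" "x' = h \<oplus>\<^bsub>L\<^esub> x" using x' by (metis rcosetE)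
    then have "c \<odot>\<^bsub>L\<^esub> x' = c \<odot>\<^bsub>L\<^esub> h \<oplus>\<^bsub>L\<^esub> c \<odot>\<^bsub>L\<^esub> x"
      using smult_r_distr[OF c] x S.a_Hcarr by auto
    then show ?thesis using rcoset_absorb[OF ideal_smult] h x c by simp
  qed
  then have "(\<Union>a\<in>I +>\<^bsub>L\<^esub> x. I +>\<^bsub>L\<^esub> (c \<odot>\<^bsub>L\<^esub> a)) = (\<Union>a\<in>I +>\<^bsub>L\<^esub> x. I +>\<^bsub>L\<^esub> (c \<odot>\<^bsub>L\<^esub> x))"
    by (rule SUP_cong[OF refl])
  also have "\<dots> = I +>\<^bsub>L\<^esub> (c \<odot>\<^bsub>L\<^esub> x)"
    using S.a_rcos_self[OF x] by (simp only: UN_constant) (simp split: if_splits, fast)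
  finally show ?thesis by (simp add: quotient_lie_def ring.defs)
qed

lemma quotient_simps:
  "carrier (quotient_lie L I) = (+>\<^bsub>L\<^esub>) I ` carrier L"
  "\<zero>\<^bsub>quotient_lie L I\<^esub> = I +>\<^bsub>L\<^esub> \<zero>\<^bsub>L\<^esub>"
  "\<lbrakk>x \<in> carrier L; y \<in> carrier L\<rbrakk> \<Longrightarrow>
    (I +>\<^bsub>L\<^esub> x) \<oplus>\<^bsub>quotient_lie L I\<^esub> (I +>\<^bsub>L\<^esub> y) = I +>\<^bsub>L\<^esub> (x \<oplus>\<^bsub>L\<^esub> y)"
  "\<lbrakk>x \<in> carrier L; y \<in> carrier L\<rbrakk> \<Longrightarrow>
    (I +>\<^bsub>L\<^esub> x) \<otimes>\<^bsub>quotient_lie L I\<^esub> (I +>\<^bsub>L\<^esub> y) = I +>\<^bsub>L\<^esub> (x \<otimes>\<^bsub>L\<^esub> y)"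
proof -
  have "I +>\<^bsub>L\<^esub> \<zero>\<^bsub>L\<^esub> = I" using M.a_coset_add_zero[OF S.a_subset] .
  then show "\<zero>\<^bsub>quotient_lie L I\<^esub> = I +>\<^bsub>L\<^esub> \<zero>\<^bsub>L\<^esub>"
    by (simp add: quotient_lie_def ring.defs FactRing_def)
qed (auto simp: quotient_lie_def ring.defs FactRing_simps rcoset_bracket S.a_rcos_sum)

theorem lie_algebra_quotient: "lie_algebra (quotient_lie L I)"
proof -
  have C: "carrier complex_ring = UNIV" by (simp add: complex_ring_def)
  have [simp]: "c \<odot>\<^bsub>L\<^esub> x \<in> carrier L" if "x \<in> carrier L" for c x
    using that smult_closed C by simp
  note [simp] = quotient_simps rcoset_smult bracket_closed
  have "abelian_group (quotient_lie L I)"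
  proof (rule abelian_groupI)
    fix X assume "X \<in> carrier (quotient_lie L I)"
    then obtain x where x: "x \<in> carrier L" "X = I +>\<^bsub>L\<^esub> x" by auto
    then show "\<exists>Y\<in>carrier (quotient_lie L I). Y \<oplus>\<^bsub>quotient_lie L I\<^esub> X = \<zero>\<^bsub>quotient_lie L I\<^esub>"
      by (intro bexI[of _ "I +>\<^bsub>L\<^esub> (\<ominus>\<^bsub>L\<^esub> x)"]) (auto simp: M.l_neg)
  qed (auto simp: M.a_assoc M.a_comm M.a_lcomm)
  then have "Module.module complex_ring (quotient_lie L I)"
    by (intro moduleI complex_ring_cring)
      (auto simp: C smult_l_distr smult_r_distr smult_assoc1)
  then show ?thesis
    by (intro lie_algebra.intro lie_algebra_axioms.intro)
      (auto simp: bracket_add_left bracket_add_right bracket_smult_left bracket_smult_right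
        bracket_self jacobi)
qed

end

lemma lie_algebra_lie_a: "lie_algebra (lie_a r)"
  unfolding lie_a_def by (rule lie_ideal.lie_algebra_quotient[OF lie_ideal_V_ideal])

end

theory Submission
  imports Defs "HOL-Computational_Algebra.Fundamental_Theorem_Algebra"
begin

text \<open>
  Everything rests on Schur-type arguments: an annihilator, a kernel or an image that happens to be
  a submodule of a simple module is either \<open>{0}\<close> or the whole space.

  The space \<open>B\<^sub>r\<close> of vectors killed by all \<open>d\<^sub>i\<close> with \<open>i > r\<close> is a submodule, because bracketing
  with \<open>d\<^sub>j\<close>, \<open>j \<ge> 0\<close>, does not lower the index (\<open>lie_submodule_annihilated_above\<close>). Local
  nilpotency makes some \<open>B\<^sub>r\<close> nonzero, hence equal to \<open>B\<close>; for the least such \<open>r\<close> every nonzero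
  vector has order exactly \<open>r\<close>. Now \<open>d\<^sub>k = 0\<close> on \<open>B\<close> for \<open>k > r\<close>, so \<open>d\<^sub>r\<close> commutes with all \<open>d\<^sub>j\<close>
  up to a multiple of itself. Its kernel and its image are therefore submodules, and it
  is either zero or bijective. It vanishes only if \<open>r = 0\<close> and \<open>B\<close> is trivial, by minimality of \<open>r\<close>.

  Order \<open>0\<close> means that only \<open>d\<^sub>0\<close> acts, so that \<open>B\<close> has no proper nonzero subspace invariant
  under one operator. Such an operator over \<open>\<complex>\<close> has an eigenvector even when no finiteness is
  assumed beforehand (\<open>irreducible_operator_eigenvector\<close>), and its line is all of \<open>B\<close>. Conversely,
  on a line operators commute, so \<open>[d\<^sub>0, d\<^sub>i] = i d\<^sub>i\<close> acts by \<open>0\<close>.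

  Finally, the ideal spanned by the \<open>d\<^sub>i\<close>, \<open>i > r\<close>, acts by zero, so the action descends to the
  quotient by that ideal, with the same invariant subspaces.
\<close>

section \<open>Irreducible operators over the complex numbers\<close>

locale complex_operator = vector_space scale
  for scale :: "complex \<Rightarrow> 'v::ab_group_add \<Rightarrow> 'v" +
  fixes T :: "'v \<Rightarrow> 'v"
  assumes linear_T: "Vector_Spaces.linear scale scale T"
begin

lemma T_simps:
  "T 0 = 0" "T (x + y) = T x + T y" "T (scale c x) = scale c (T x)"
  "T (x - y) = T x - T y"
  using linear_T by (simp_all add: module_hom.add module_hom.scale module_hom.zero module_hom.diff
      Vector_Spaces.linear_iff_module_hom)

text \<open>This is \<open>p(T) w\<close> in Horner form.\<close>

definition poly_apply :: "'v \<Rightarrow> complex poly \<Rightarrow> 'v" where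
  "poly_apply w p = fold_coeffs (\<lambda>a u. scale a w + T u) p 0"

lemma poly_apply_0 [simp]: "poly_apply w 0 = 0"
  by (simp add: poly_apply_def)

lemma poly_apply_pCons [simp]:
  "poly_apply w (pCons a p) = scale a w + T (poly_apply w p)"
  by (cases "a = 0 \<and> p = 0") (auto simp: poly_apply_def T_simps)

lemma poly_apply_add: "poly_apply w (p + q) = poly_apply w p + poly_apply w q"
  by (induction p q rule: poly_induct2) (simp_all add: T_simps scale_left_distrib)

lemma poly_apply_smult: "poly_apply w (Polynomial.smult c p) = scale c (poly_apply w p)"
  by (induction p) (simp_all add: T_simps scale_right_distrib)

text \<open>Splitting \<open>p\<close> into linear factors, the last nonzero vector before \<open>p(T) w = 0\<close> is reached
  is an eigenvector.\<close>

lemma eigenvector_if_annihilated: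
  assumes "p \<noteq> 0" and "w \<noteq> 0" and "poly_apply w p = 0"
  shows "\<exists>u c. u \<noteq> 0 \<and> T u = scale c u"
  using assms(1,3)
proof (induction "degree p" arbitrary: p)
  case 0
  then obtain a where "p = [:a:]" by (metis degree_eq_zeroE)
  with 0 \<open>w \<noteq> 0\<close> show ?case by (simp add: T_simps)
next
  case (Suc n)
  have "\<not> constant (poly p)" using Suc.hyps(2) by (simp add: constant_degree)
  then obtain c where "poly p c = 0" using fundamental_theorem_of_algebra by blast
  then obtain q where q: "p = [:- c, 1:] * q" by (auto simp: poly_eq_0_iff_dvd)
  with Suc.prems have "q \<noteq> 0" by auto
  then have "degree p = degree [:- c, 1:] + degree q" unfolding q by (intro degree_mult_eq) simp_all
  with Suc.hyps(2) have "degree q = n" by simp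
  have p: "p = Polynomial.smult (- c) q + pCons 0 q" by (simp add: q)
  have "T (poly_apply w q) = scale c (poly_apply w q)"
    using Suc.prems(2) unfolding p poly_apply_add poly_apply_smult by simp
  with Suc.hyps(1)[of q] \<open>degree q = n\<close> \<open>q \<noteq> 0\<close> show ?case by blast
qed

text \<open>If \<open>T w \<noteq> 0\<close>, then by irreducibility the invariant subspace generated by \<open>T w\<close> contains \<open>w\<close>,
  so that \<open>w = T (p(T) w)\<close> for some \<open>p\<close>. The polynomial \<open>x p(x) - 1\<close> then annihilates \<open>w\<close>, and it is
  nonzero because of its constant term.\<close>

theorem irreducible_operator_eigenvector:
  fixes w :: 'v
  assumes irreducible:
      "\<And>U. subspace U \<Longrightarrow> (\<And>u. u \<in> U \<Longrightarrow> T u \<in> U) \<Longrightarrow> U = {0} \<or> U = UNIV"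
    and "w \<noteq> 0"
  shows "\<exists>u c. u \<noteq> 0 \<and> T u = scale c u"
proof (cases "T w = 0")
  case True
  with \<open>w \<noteq> 0\<close> show ?thesis by (intro exI[of _ w] exI[of _ 0]) simp
next
  case False
  define U where "U = range (\<lambda>p. poly_apply w (pCons 0 p))"
  have "subspace U"
    unfolding subspace_def
  proof (intro conjI ballI allI)
    show "0 \<in> U" unfolding U_def by (rule range_eqI[of _ _ 0]) (simp add: T_simps)
  next
    fix x y assume "x \<in> U" "y \<in> U"
    then obtain p q where "x = poly_apply w (pCons 0 p)" "y = poly_apply w (pCons 0 q)"
      by (auto simp: U_def)
    then show "x + y \<in> U" unfolding U_def
      by (intro range_eqI[of _ _ "p + q"]) (simp add: poly_apply_add T_simps)
  next
    fix c x assume "x \<in> U"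
    then obtain p where "x = poly_apply w (pCons 0 p)" by (auto simp: U_def)
    then show "scale c x \<in> U" unfolding U_def
      by (intro range_eqI[of _ _ "Polynomial.smult c p"]) (simp add: poly_apply_smult T_simps)
  qed
  moreover have "T u \<in> U" if "u \<in> U" for u
  proof -
    obtain p where "u = poly_apply w (pCons 0 p)" using \<open>u \<in> U\<close> by (auto simp: U_def)
    then show ?thesis unfolding U_def by (intro range_eqI[of _ _ "pCons 0 p"]) simp
  qed
  moreover have "T w \<in> U"
    unfolding U_def by (rule range_eqI[of _ _ 1]) (simp add: one_pCons T_simps)
  ultimately have "w \<in> U" using irreducible[of U] False by auto
  then obtain p where "w = T (poly_apply w p)" by (auto simp: U_def)
  then have "poly_apply w (pCons (- 1) p) = 0" by simp
  then show ?thesis by (rule eigenvector_if_annihilated[rotated 2]) (use \<open>w \<noteq> 0\<close> in simp_all)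
qed

end

section \<open>Actions that factor through a quotient Lie algebra\<close>

text \<open>Any representative of the coset may be used once the ideal acts by zero
  (\<open>quotient_act_rcoset\<close>).\<close>

definition quotient_act :: "('a \<Rightarrow> 'v \<Rightarrow> 'v) \<Rightarrow> 'a set \<Rightarrow> 'v \<Rightarrow> 'v" where
  "quotient_act act A = act (SOME x. x \<in> A)"

locale lie_module_killed_by_ideal = lie_module L scale act + lie_ideal L I
  for L :: "(complex, 'a, 'm) module_scheme" (structure)
    and scale :: "complex \<Rightarrow> 'v::ab_group_add \<Rightarrow> 'v" and act and I +
  assumes act_ideal: "x \<in> I \<Longrightarrow> act x v = 0"
begin

lemma quotient_act_rcoset:
  assumes x: "x \<in> carrier L"
  shows "quotient_act act (I +>\<^bsub>L\<^esub> x) = act x"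
proof -
  have sub: "abelian_subgroup I L" by (rule abelian_subgroup_I)
  then have "x \<in> I +>\<^bsub>L\<^esub> x" using x by (rule abelian_subgroup.a_rcos_self)
  then have "(SOME y. y \<in> I +>\<^bsub>L\<^esub> x) \<in> I +>\<^bsub>L\<^esub> x" by (rule someI)
  then obtain h where h: "h \<in> I" and rep: "(SOME y. y \<in> I +>\<^bsub>L\<^esub> x) = h \<oplus>\<^bsub>L\<^esub> x"
    by (rule rcosetE)
  have "h \<in> carrier L" using ideal_additive h by (rule additive_subgroup.a_Hcarr)
  with h x show ?thesis unfolding quotient_act_def rep by (auto simp: act_add act_ideal)
qed

theorem lie_module_quotient: "lie_module (quotient_lie L I) scale (quotient_act act)"
proof (intro lie_module.intro lie_module_axioms.intro lie_algebra_quotient V.vector_space_axioms)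
  have [simp]: "c \<odot>\<^bsub>L\<^esub> x \<in> carrier L" if "x \<in> carrier L" for c x
    using that smult_closed by (simp add: complex_ring_def)
  note [simp] = quotient_simps rcoset_smult bracket_closed quotient_act_rcoset
  {
    fix X assume "X \<in> carrier (quotient_lie L I)"
    then show "Vector_Spaces.linear scale scale (quotient_act act X)"
      by (auto simp: act_linear)
  next
    fix X Y v assume "X \<in> carrier (quotient_lie L I)" "Y \<in> carrier (quotient_lie L I)"
    then show "quotient_act act (X \<oplus>\<^bsub>quotient_lie L I\<^esub> Y) v =
        quotient_act act X v + quotient_act act Y v"
      by (auto simp: act_add)
  next
    fix X c v assume "X \<in> carrier (quotient_lie L I)"
    then show "quotient_act act (c \<odot>\<^bsub>quotient_lie L I\<^esub> X) v = scale c (quotient_act act X v)"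
      by (auto simp: act_smult)
  next
    fix X Y v assume "X \<in> carrier (quotient_lie L I)" "Y \<in> carrier (quotient_lie L I)"
    then show "quotient_act act (X \<otimes>\<^bsub>quotient_lie L I\<^esub> Y) v =
        quotient_act act X (quotient_act act Y v) - quotient_act act Y (quotient_act act X v)"
      by (auto simp: act_bracket)
  }
qed

lemma lie_submodule_quotient_iff:
  "lie_submodule (quotient_lie L I) scale (quotient_act act) U \<longleftrightarrow> lie_submodule L scale act U"
  by (simp add: lie_submodule_def quotient_simps quotient_act_rcoset)

end

section \<open>Modules over the Lie algebra of polynomial vector fields vanishing at the origin\<close>

locale lie_b_module = lie_module lie_b scale act
  for scale :: "complex \<Rightarrow> 'v::ab_group_add \<Rightarrow> 'v" and act
begin

lemma d_carrier [simp]: "d i \<in> carrier lie_b"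
  by (auto simp: lie_b_def intro: poly_vs.span_base)

lemma act_simps:
  assumes "x \<in> carrier lie_b"
  shows "act x 0 = 0" "act x (u + v) = act x u + act x v" "act x (scale c u) = scale c (act x u)"
    "act x (u - v) = act x u - act x v"
proof -
  interpret complex_operator scale "act x"
    by (intro complex_operator.intro complex_operator_axioms.intro V.vector_space_axioms
        act_linear[OF assms])
  show "act x 0 = 0" "act x (u + v) = act x u + act x v" "act x (scale c u) = scale c (act x u)"
    "act x (u - v) = act x u - act x v"
    by (rule T_simps)+
qed

lemma act_d_commute:
  "act (d i) (act (d j) v) = act (d j) (act (d i) v) + scale (of_nat j - of_nat i) (act (d (i + j)) v)"
proof -
  have "act (d i) (act (d j) v) - act (d j) (act (d i) v) = act (d i \<otimes>\<^bsub>lie_b\<^esub> d j) v"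
    by (simp add: act_bracket)
  also have "\<dots> = scale (of_nat j - of_nat i) (act (d (i + j)) v)"
    by (simp add: lie_b_bracket_d act_smult add.commute)
  finally show ?thesis by (simp add: algebra_simps)
qed

text \<open>This reduces invariance (\<open>r = 0\<close>, \<open>U\<close> a candidate submodule) and vanishing (\<open>U = {0}\<close>) to the
  basis elements \<open>d\<^sub>i\<close>.\<close>

lemma act_V_ideal_in_subspace:
  assumes U: "V.subspace U" and d: "\<And>i. r \<le> i \<Longrightarrow> act (d i) v \<in> U" and p: "p \<in> V_ideal r"
  shows "act p v \<in> U"
proof -
  have add: "p + q = p \<oplus>\<^bsub>lie_b\<^esub> q" and smult: "Polynomial.smult c p = c \<odot>\<^bsub>lie_b\<^esub> p" for p q c
    by (simp_all add: lie_b_def)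
  have carrier: "poly_vs.subspace (carrier lie_b)"
    by (simp add: lie_b_def poly_vs.subspace_span)
  have 0: "act 0 v = 0"
    using act_smult[of 0 0 v] poly_vs.subspace_0[OF carrier]
    by (simp add: smult[symmetric])
  have "poly_vs.subspace {q \<in> carrier lie_b. act q v \<in> U}"
    using carrier U
    by (auto simp: poly_vs.subspace_def V.subspace_def 0 act_add[folded add] act_smult[folded smult])
  then have "V_ideal r \<subseteq> {q \<in> carrier lie_b. act q v \<in> U}"
    unfolding V_ideal_def by (rule poly_vs.span_minimal[rotated]) (auto intro: d)
  with p show ?thesis by blast
qed

lemma lie_submodule_iff:
  "lie_submodule lie_b scale act U \<longleftrightarrow> V.subspace U \<and> (\<forall>i. \<forall>u\<in>U. act (d i) u \<in> U)"
  unfolding lie_submodule_def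
  using act_V_ideal_in_subspace[of U 0] by (auto simp: carrier_lie_b simp flip: carrier_lie_b)

lemma trivial_iff: "trivial_lie_module lie_b act \<longleftrightarrow> (\<forall>i v. act (d i) v = 0)"
  unfolding trivial_lie_module_def carrier_lie_b
  using act_V_ideal_in_subspace[of "{0}" 0] d_carrier
  by (auto simp: V.subspace_single_0 carrier_lie_b)

text \<open>The \<open>d\<^sub>k\<close> with \<open>k > r\<close> span an ideal, and the vectors killed by an ideal form a submodule.\<close>

lemma lie_submodule_annihilated_above:
  "lie_submodule lie_b scale act {v. \<forall>k>r. act (d k) v = 0}"
  unfolding lie_submodule_iff V.subspace_def
  by (auto simp: act_simps) (subst act_d_commute, simp add: act_simps)

text \<open>Once \<open>d\<^sub>k\<close> vanishes for all \<open>k > r\<close>, the operator \<open>d\<^sub>r\<close> commutes with \<open>d\<^sub>j\<close> for \<open>j \<ge> 1\<close>, and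
  \<open>[d\<^sub>r, d\<^sub>0]\<close> is a multiple of \<open>d\<^sub>r\<close>.\<close>

lemma act_d_top_commute:
  assumes "\<And>k v. r < k \<Longrightarrow> act (d k) v = 0"
  shows "\<exists>c. \<forall>v. act (d r) (act (d j) v) = act (d j) (act (d r) v) + scale c (act (d r) v)"
proof (cases "j = 0")
  case True
  then show ?thesis using act_d_commute[of r 0] by (auto intro!: exI[of _ "- of_nat r"])
next
  case False
  then show ?thesis using act_d_commute[of r j] assms by (auto intro!: exI[of _ 0])
qed

lemma lie_submodule_kernel_top:
  assumes "\<And>k v. r < k \<Longrightarrow> act (d k) v = 0"
  shows "lie_submodule lie_b scale act {v. act (d r) v = 0}"
proof -
  have "act (d r) (act (d j) v) = 0" if "act (d r) v = 0" for j v
    using act_d_top_commute[OF assms, of r j] that by (auto simp: act_simps)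
  then show ?thesis unfolding lie_submodule_iff V.subspace_def by (auto simp: act_simps)
qed

lemma lie_submodule_image_top:
  assumes "\<And>k v. r < k \<Longrightarrow> act (d k) v = 0"
  shows "lie_submodule lie_b scale act (range (act (d r)))"
proof -
  have "act (d j) (act (d r) v) \<in> range (act (d r))" for j v
  proof -
    obtain c where "act (d r) (act (d j) v) = act (d j) (act (d r) v) + scale c (act (d r) v)"
      using act_d_top_commute[OF assms, of r j] by blast
    then have "act (d j) (act (d r) v) = act (d r) (act (d j) v - scale c v)"
      by (simp add: act_simps)
    then show ?thesis by blast
  qed
  moreover have "V.subspace (range (act (d r)))"
    unfolding V.subspace_def
    by (auto simp flip: act_simps) (metis act_simps(1) d_carrier rangeI)
  ultimately show ?thesis unfolding lie_submodule_iff by blast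
qed

lemma scalar_action_if_dim_1:
  assumes "V.dim (UNIV :: 'v set) = 1"
  obtains a where "\<And>i v. act (d i) v = scale (a i) v"
proof -
  obtain S where S: "UNIV \<subseteq> V.span S" "card S = V.dim (UNIV :: 'v set)"
    using V.basis_exists[of UNIV] by blast
  then obtain b where b: "S = {b}" using assms by (metis card_1_singletonE)
  have multiple: "\<exists>c. v = scale c b" for v
    using S(1) by (auto simp: b V.span_singleton)
  have "\<exists>a. \<forall>i. act (d i) b = scale (a i) b" by (intro choice allI multiple)
  then obtain a where a: "\<And>i. act (d i) b = scale (a i) b" by blast
  have "act (d i) v = scale (a i) v" for i v
    using multiple[of v] by (auto simp: act_simps a mult.commute)
  with that show thesis by blast
qed

text \<open>Multiplications by scalars commute, while \<open>[d\<^sub>0, d\<^sub>k]\<close> is a nonzero multiple of \<open>d\<^sub>k\<close>.\<close>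

lemma act_d_eq_0_if_dim_1:
  assumes "V.dim (UNIV :: 'v set) = 1" and "0 < k"
  shows "act (d k) v = 0"
proof -
  obtain a where a: "\<And>i v. act (d i) v = scale (a i) v"
    using scalar_action_if_dim_1[OF assms(1)] by blast
  have "scale (of_nat k) (act (d k) v) = 0"
    using act_d_commute[of 0 k v] by (simp add: a mult.commute)
  with \<open>0 < k\<close> show ?thesis by simp
qed

end

section \<open>Simple modules\<close>

locale simple_lie_b_module = lie_b_module scale act
  for scale :: "complex \<Rightarrow> 'v::ab_group_add \<Rightarrow> 'v" and act +
  assumes simple: "simple_lie_module lie_b scale act"
begin

lemma nontrivial_space: "\<exists>v :: 'v. v \<noteq> 0"
  using simple by (auto simp: simple_lie_module_def)

lemma submodule_cases:
  assumes "lie_submodule lie_b scale act U"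
  obtains "U = {0}" | "U = UNIV"
  using simple assms by (auto simp: simple_lie_module_def)

lemma act_d_above_eq_0:
  assumes "v \<noteq> 0" and "\<forall>k>r. act (d k) v = 0" and "r < k"
  shows "act (d k) w = 0"
  by (rule submodule_cases[OF lie_submodule_annihilated_above[of r]]) (use assms in auto)

lemma bij_act_d_top:
  assumes above: "\<And>k v. r < k \<Longrightarrow> act (d k) v = 0" and nonzero: "act (d r) w \<noteq> 0"
  shows "bij (act (d r))"
proof -
  have kernel: "{v. act (d r) v = 0} = {0}"
    by (rule submodule_cases[OF lie_submodule_kernel_top[OF above]]) (use nonzero in auto)
  have "range (act (d r)) = UNIV"
    by (rule submodule_cases[OF lie_submodule_image_top[OF above]]) (use nonzero in auto)
  moreover have "inj (act (d r))"
  proof (rule injI)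
    fix x y assume "act (d r) x = act (d r) y"
    then have "act (d r) (x - y) = 0" by (simp add: act_simps)
    with kernel have "x - y = 0" by blast
    then show "x = y" by simp
  qed
  ultimately show ?thesis by (simp add: bij_def)
qed

lemma dim_1_if_only_d_0_acts:
  assumes "\<And>k v. 0 < k \<Longrightarrow> act (d k) v = 0"
  shows "V.dim (UNIV :: 'v set) = 1"
proof -
  interpret complex_operator scale "act (d 0)"
    by (intro complex_operator.intro complex_operator_axioms.intro V.vector_space_axioms
        act_linear d_carrier)
  have submodule: "lie_submodule lie_b scale act U"
    if "V.subspace U" "\<And>u. u \<in> U \<Longrightarrow> act (d 0) u \<in> U" for U
    unfolding lie_submodule_iff
  proof (intro conjI allI ballI that(1))
    fix i u assume "u \<in> U"
    then show "act (d i) u \<in> U"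
      using that assms[of i u] V.subspace_0[of U] by (cases "i = 0") auto
  qed
  obtain w :: 'v where "w \<noteq> 0" using nontrivial_space by blast
  then obtain u c where "u \<noteq> 0" and u: "act (d 0) u = scale c u"
    using irreducible_operator_eigenvector submodule submodule_cases by metis
  have "lie_submodule lie_b scale act (V.span {u})"
    by (rule submodule[OF V.subspace_span])
      (auto simp: V.span_singleton act_simps u)
  then have "V.span {u} = UNIV"
    by (rule submodule_cases) (use \<open>u \<noteq> 0\<close> V.span_base[of u "{u}"] in auto)
  then have "V.dim (UNIV :: 'v set) = card {u}"
    using \<open>u \<noteq> 0\<close> by (intro V.dim_unique[of "{u}"]) (auto simp: V.dependent_single)
  then show ?thesis by simp
qed

lemma simple_lie_module_lie_a:
  assumes "\<And>k v. r < k \<Longrightarrow> act (d k) v = 0"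
  shows "simple_lie_module (lie_a r) scale (quotient_act act)"
    and "x \<in> carrier lie_b \<Longrightarrow> quotient_act act (V_ideal (r + 1) +>\<^bsub>lie_b\<^esub> x) = act x"
proof -
  have "act x v = 0" if "x \<in> V_ideal (r + 1)" for x v
    using act_V_ideal_in_subspace[of "{0}" "r + 1" v x] that assms by (simp add: V.subspace_single_0)
  then interpret Q: lie_module_killed_by_ideal lie_b scale act "V_ideal (r + 1)"
    by (intro lie_module_killed_by_ideal.intro lie_module_killed_by_ideal_axioms.intro
        lie_module_axioms lie_ideal_V_ideal)
  show "simple_lie_module (lie_a r) scale (quotient_act act)"
    using simple Q.lie_module_quotient
    unfolding simple_lie_module_def lie_a_def Q.lie_submodule_quotient_iff by blast
  show "x \<in> carrier lie_b \<Longrightarrow> quotient_act act (V_ideal (r + 1) +>\<^bsub>lie_b\<^esub> x) = act x"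
    by (rule Q.quotient_act_rcoset)
qed

end

section \<open>The order of a simple module\<close>

lemma vec_ord_eq_enatI:
  assumes "\<And>k. r < k \<Longrightarrow> act (d k) v = 0"
    and "\<And>s. s < r \<Longrightarrow> \<exists>k>s. act (d k) v \<noteq> 0"
  shows "vec_ord act v = enat r"
proof -
  have iff: "(\<forall>i\<ge>1. act (d (s + i)) v = 0) \<longleftrightarrow> (\<forall>k>s. act (d k) v = 0)" for s
    by (metis One_nat_def Suc_leI le_add_diff_inverse less_add_same_cancel1 less_eq_Suc_le
        less_imp_le_nat zero_less_diff)
  have "(LEAST s. \<forall>k>s. act (d k) v = 0) = r"
    using assms by (intro Least_equality) (auto simp: not_less[symmetric])
  with assms(1) show ?thesis unfolding vec_ord_def iff by auto
qed

lemma mod_ord_eqI: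
  fixes w :: "'v::ab_group_add" and act :: "complex poly \<Rightarrow> 'v \<Rightarrow> 'v"
  assumes "\<And>v. v \<noteq> 0 \<Longrightarrow> vec_ord act v = n" and "w \<noteq> 0"
  shows "mod_ord act = n"
proof -
  have "(GREATEST m. \<exists>v. v \<noteq> 0 \<and> m = vec_ord act v) = n"
    using assms by (intro Greatest_equality) auto
  with assms show ?thesis unfolding mod_ord_def by auto
qed

theorem (in simple_lie_b_module) order_of_simple_module:
  assumes "in_category_O scale act"
  obtains r where "\<And>k v. r < k \<Longrightarrow> act (d k) v = 0"
    and "\<And>v. v \<noteq> 0 \<Longrightarrow> vec_ord act v = enat r"
    and "\<And>s v. s < r \<Longrightarrow> v \<noteq> 0 \<Longrightarrow> \<exists>k>s. act (d k) v \<noteq> 0"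
    and "mod_ord act = enat r"
proof -
  obtain w :: 'v where w: "w \<noteq> 0" using nontrivial_space by blast
  define r where "r = (LEAST s. \<forall>k>s. act (d k) w = 0)"
  have "\<exists>s. \<forall>k>s. act (d k) w = 0"
    using assms unfolding in_category_O_def by (meson less_imp_le)
  then have "\<forall>k>r. act (d k) w = 0" unfolding r_def by (rule LeastI_ex)
  with w have above: "act (d k) v = 0" if "r < k" for k v
    using that act_d_above_eq_0 by blast
  have least: "\<exists>k>s. act (d k) v \<noteq> 0" if "s < r" "v \<noteq> 0" for s v
  proof (rule ccontr)
    assume "\<not> (\<exists>k>s. act (d k) v \<noteq> 0)"
    with \<open>v \<noteq> 0\<close> have "\<forall>k>s. act (d k) w = 0" using act_d_above_eq_0 by blast
    then have "r \<le> s" unfolding r_def by (rule Least_le)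
    with \<open>s < r\<close> show False by simp
  qed
  have vec: "vec_ord act v = enat r" if "v \<noteq> 0" for v
    using that above least by (intro vec_ord_eq_enatI) auto
  then have "mod_ord act = enat r" using w by (rule mod_ord_eqI)
  with that above vec least show thesis by blast
qed

theorem lemma1:
  fixes scale :: "complex \<Rightarrow> 'v::ab_group_add \<Rightarrow> 'v"
    and act :: "complex poly \<Rightarrow> 'v \<Rightarrow> 'v"
  assumes "in_category_O scale act"
    and "simple_lie_module lie_b scale act"
  shows "(\<forall>v. v \<noteq> 0 \<longrightarrow> mod_ord act = vec_ord act v \<and> vec_ord act v < \<infinity>)
    \<and> (mod_ord act = 0 \<longleftrightarrow> vector_space.dim scale (UNIV :: 'v set) = 1)
    \<and> (\<not> trivial_lie_module lie_b act \<longrightarrow> (\<exists>r. mod_ord act = enat r \<and> bij (act (d r))))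
    \<and> (\<exists>r\<ge>1. \<exists>act'. simple_lie_module (lie_a r) scale act' \<and>
          (\<forall>x\<in>carrier lie_b. act' (V_ideal (r + 1) +>\<^bsub>lie_b\<^esub> x) = act x))"
proof -
  interpret simple_lie_b_module scale act
    using assms(2) by (intro simple_lie_b_module.intro lie_b_module.intro
        simple_lie_b_module_axioms.intro) (simp_all add: simple_lie_module_def)
  obtain r where above: "\<And>k v. r < k \<Longrightarrow> act (d k) v = 0"
    and vec: "\<And>v. v \<noteq> 0 \<Longrightarrow> vec_ord act v = enat r"
    and least: "\<And>s v. s < r \<Longrightarrow> v \<noteq> 0 \<Longrightarrow> \<exists>k>s. act (d k) v \<noteq> 0"
    and ord: "mod_ord act = enat r"
    using order_of_simple_module[OF assms(1)] by blast
  obtain w :: 'v where w: "w \<noteq> 0" using nontrivial_space by blast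
  have dim: "r = 0 \<longleftrightarrow> V.dim (UNIV :: 'v set) = 1"
  proof
    assume "r = 0"
    with above show "V.dim (UNIV :: 'v set) = 1" by (intro dim_1_if_only_d_0_acts) simp
  next
    assume "V.dim (UNIV :: 'v set) = 1"
    then have "vec_ord act w = enat 0" by (intro vec_ord_eq_enatI) (simp_all add: act_d_eq_0_if_dim_1)
    with vec w show "r = 0" by simp
  qed
  have bij: "bij (act (d r))" if "\<not> trivial_lie_module lie_b act"
  proof -
    have "\<exists>v. act (d r) v \<noteq> 0"
    proof (rule ccontr)
      assume "\<not> (\<exists>v. act (d r) v \<noteq> 0)"
      with above have zero: "act (d k) v = 0" if "r \<le> k" for k v
        using that le_neq_implies_less by metis
      show False
      proof (cases r)
        case 0
        with zero \<open>\<not> trivial_lie_module lie_b act\<close> show False by (simp add: trivial_iff)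
      next
        case (Suc s)
        with zero least[of s w] w show False by auto
      qed
    qed
    with above show ?thesis using bij_act_d_top by blast
  qed
  \<comment> \<open>A module of order \<open>0\<close> is regarded as a module over \<open>\<aa>\<^sub>1\<close>.\<close>
  have "act (d k) v = 0" if "max r 1 < k" for k v using above that by simp
  note quotient = simple_lie_module_lie_a[where r = "max r 1", OF this]
  have "\<exists>r\<ge>1. \<exists>act'. simple_lie_module (lie_a r) scale act' \<and>
          (\<forall>x\<in>carrier lie_b. act' (V_ideal (r + 1) +>\<^bsub>lie_b\<^esub> x) = act x)"
    by (intro exI[of _ "max r 1"] exI[of _ "quotient_act act"]) (use quotient in auto)
  with vec ord dim bij show ?thesis by (simp add: zero_enat_def)
qed

end
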